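(* Let $n,m\ge 1$ be integers, let $0<\lambda_{\min}\le\lambda_{\max}<+\infty$, and let $A\in\mathbb{R}^{n\times n}$ be symmetric with $\lambda_{\min} I_n\preceq A\preceq \lambda_{\max} I_n$. Let $A=V\Lambda V^\top$ be an eigendecomposition with $V$ orthogonal and $\Lambda=\mathrm{diag}(\lambda_1,\dots,\lambda_n)$. Let $F\in\mathbb{R}^{m\times m}$, $H\in\mathbb{R}^{m\times 1}$, $K\in\mathbb{R}^{1\times m}$ be the controller data described in the context, and for $\lambda\in\mathbb{R}$ put $F(\lambda):=F+\lambda HK$. Given $\gamma>0$, suppose there exist a matrix $\overline{Q}=\overline{Q}^\top\in\mathbb{R}^{m\times m}$ with $\overline{Q}\succ0$, a scalar $\delta>0$ and a scalar $\xi\neq0$ such that, for both $\lambda=\lambda_{\min}$ and $\lambda=\lambda_{\max}$, the following symmetric matrix (where $\star$ denotes entries determined by symmetry) is negative definite: $$\begin{bmatrix}\overline{Q}F(\lambda)^\top+F(\lambda)\overline{Q} & H(\xi-\delta\lambda)+\overline{Q}K^\top & H & \lambda\,\overline{Q}K^\top\\ \star & -2\delta & 0 & \delta(1-\lambda)\\ \star&\star&-\gamma&1\\ \star&\star&\star&-\gamma\end{bmatrix}\prec0 .$$ Then, with the anti-windup gain $\rho:=\xi/\delta$, the closed-loop system $(\mathcal{S}_{\rho})$ defined in the context achieves quadratic performance of level $\gamma$ for all $\phi$ belonging to $\Phi_I$, in the sense defined in the context.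
   Context: Notation: $M\succ0$, $M\prec 0$, $M\succeq0$ denote positive definiteness, negative definiteness and positive semidefiniteness; for a non-symmetric square matrix $M$, $M\succeq0$ means $M+M^\top\succeq0$. $\otimes$ is the Kronecker product. Controller data: $F\in\mathbb{R}^{m\times m}$ is marginally stable (its eigenvalues have nonpositive real part; repeated eigenvalues on the imaginary axis are allowed), $H\in\mathbb{R}^{m\times1}$, and $K\in\mathbb{R}^{1\times m}$ is chosen so that $F+\lambda HK$ is Hurwitz (all eigenvalues have negative real part) for every $\lambda\in[\lambda_{\min},\lambda_{\max}]$. Put $F_{ext}=I_n\otimes F$, $H_{ext}=I_n\otimes H$, $K_{ext}=I_n\otimes K$. The class $\Phi_I$: a function $\phi:\mathbb{R}^n\to\mathbb{R}^n$ belongs to $\Phi_I$ if (1) $\phi(0)=0$; (2) $\phi$ is locally Lipschitz continuous; (3) $\left(\frac{\partial\phi}{\partial u}(u)\right)^\top\left(I_n-\frac{\partial\phi}{\partial u}(u)\right)\succeq0$ for almost all $u\in\mathbb{R}^n$, where $\frac{\partial\phi}{\partial u}(u)$ is the Jacobian of $\phi$ at $u$. Closed-loop system $(\mathcal{S}_\rho)$: for $\rho\in\mathbb{R}$, a nonlinearity $\phi:\mathbb{R}^n\to\mathbb{R}^n$, state $\eta\in\mathbb{R}^{nm}$ and exogenous input $\overline b\in\mathbb{R}^n$, $$\dot\eta=F_{ext}\,\eta+H_{ext}\,\overline u,\qquad \overline p=K_{ext}\,\eta,\qquad \overline x=\phi(\overline p),\qquad \overline w=\overline p-\overline x,\qquad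 \overline u=\Lambda\overline x+\overline b+\rho\,\overline w,$$ with performance output $\overline z=\Lambda\overline x+\overline b+\overline w$. Quadratic performance: given $\gamma>0$, the system $(\mathcal{S}_\rho)$ achieves quadratic performance of level $\gamma$ for all $\phi$ belonging to $\Phi_I$ if there exist a scalar $\epsilon>0$ and a quadratic Lyapunov function $\mathcal V(\eta)=\eta^\top P\eta$, with $P=P^\top\succ0$, such that for every $\phi\in\Phi_I$ the derivative $\dot{\mathcal V}$ of $\mathcal V$ along the dynamics of $(\mathcal{S}_\rho)$, i.e. $\dot{\mathcal V}=2\eta^\top P(F_{ext}\eta+H_{ext}\overline u)$, satisfies $$\dot{\mathcal V}<-\epsilon\,\eta^\top\eta-\frac1\gamma\,\overline z^\top\overline z+\gamma\,\overline b^\top\overline b\qquad\text{for all }(\eta,\overline b)\in\mathbb{R}^{nm}\times\mathbb{R}^n,\ (\eta,\overline b)\neq(0,0).$$ *)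

theory Defs
  imports "HOL-Analysis.Analysis"
begin

definition pos_semidef :: "real^'a^'a \<Rightarrow> bool" where
  "pos_semidef M \<longleftrightarrow> transpose M = M \<and> (\<forall>x. 0 \<le> x \<bullet> (M *v x))"

definition pos_def :: "real^'a^'a \<Rightarrow> bool" where
  "pos_def M \<longleftrightarrow> transpose M = M \<and> (\<forall>x. x \<noteq> 0 \<longrightarrow> 0 < x \<bullet> (M *v x))"

definition neg_def :: "real^'a^'a \<Rightarrow> bool" where
  "neg_def M \<longleftrightarrow> transpose M = M \<and> (\<forall>x. x \<noteq> 0 \<longrightarrow> x \<bullet> (M *v x) < 0)"

text \<open>Semidefiniteness of a not necessarily symmetric matrix refers to its symmetric part.\<close>
definition nonsym_pos_semidef :: "real^'a^'a \<Rightarrow> bool" where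
  "nonsym_pos_semidef M \<longleftrightarrow> pos_semidef (M + transpose M)"

definition diag_matrix :: "real^'a \<Rightarrow> real^'a^'a" where
  "diag_matrix d = (\<chi> i j. if i = j then d $ i else 0)"

definition eigenvalues :: "real^'a^'a \<Rightarrow> complex set" where
  "eigenvalues M = {s. \<exists>v. v \<noteq> 0 \<and> map_matrix complex_of_real M *v v = s *s v}"

definition hurwitz :: "real^'a^'a \<Rightarrow> bool" where
  "hurwitz M \<longleftrightarrow> (\<forall>s\<in>eigenvalues M. Re s < 0)"

text \<open>Repeated eigenvalues, even defective ones, on the imaginary axis are allowed.\<close>
definition marginally_stable :: "real^'a^'a \<Rightarrow> bool" where
  "marginally_stable M \<longleftrightarrow> (\<forall>s\<in>eigenvalues M. Re s \<le> 0)"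

text \<open>Kronecker product; block index first, index within the block second.\<close>
definition kron :: "real^'b^'a \<Rightarrow> real^'d^'c \<Rightarrow> real^('b \<times> 'd)^('a \<times> 'c)" where
  "kron A B = (\<chi> i j. A $ fst i $ fst j * B $ snd i $ snd j)"

definition F_ext :: "real^'m^'m \<Rightarrow> real^('n::finite \<times> 'm)^('n \<times> 'm)" where
  "F_ext F = kron (mat 1) F"

text \<open>The index type of the Kronecker product with a single column or row is
  \<open>'n \<times> 1\<close>, which is identified with \<open>'n\<close> in the next two definitions.\<close>
definition H_ext :: "real^1^'m \<Rightarrow> real^('n::finite)^('n \<times> 'm)" where
  "H_ext H = (\<chi> i j. kron (mat 1 :: real^'n^'n) H $ i $ (j, 1))"

definition K_ext :: "real^'m^1 \<Rightarrow> real^('n \<times> 'm)^('n::finite)" where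
  "K_ext K = (\<chi> i j. kron (mat 1 :: real^'n^'n) K $ (i, 1) $ j)"

text \<open>By Rademacher's theorem the differentiability conjunct is implied by local Lipschitz
  continuity; it only excludes the points at which \<open>jacobian\<close> is meaningless.\<close>
definition Phi_I :: "(real^'n \<Rightarrow> real^'n) set" where
  "Phi_I = {\<phi>. \<phi> 0 = 0
     \<and> (\<forall>u. \<exists>r>0. \<exists>L. L-lipschitz_on (cball u r) \<phi>)
     \<and> (AE u in lebesgue. \<phi> differentiable (at u) \<and>
          nonsym_pos_semidef (transpose (jacobian \<phi> (at u)) ** (mat 1 - jacobian \<phi> (at u))))}"

definition quadratic_performance ::
  "real^'m^'m \<Rightarrow> real^1^'m \<Rightarrow> real^'m^1 \<Rightarrow> real^'n^'n \<Rightarrow> real \<Rightarrow> real \<Rightarrow> bool" where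
  "quadratic_performance F H K \<Lambda> \<rho> \<gamma> \<longleftrightarrow>
     (\<exists>\<epsilon>>0. \<exists>P :: real^('n \<times> 'm)^('n \<times> 'm). pos_def P \<and>
       (\<forall>\<phi>\<in>Phi_I. \<forall>(\<eta> :: real^('n \<times> 'm)) (b :: real^'n). (\<eta>, b) \<noteq> (0, 0) \<longrightarrow>
         (let p = K_ext K *v \<eta>;
              x = \<phi> p;
              w = p - x;
              u = \<Lambda> *v x + b + \<rho> *\<^sub>R w;
              z = \<Lambda> *v x + b + w;
              V_dot = 2 * (\<eta> \<bullet> (P *v (F_ext F *v \<eta> + H_ext H *v u)))
          in V_dot < - \<epsilon> * (\<eta> \<bullet> \<eta>) - (1 / \<gamma>) * (z \<bullet> z) + \<gamma> * (b \<bullet> b))))"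

definition hcat :: "real^'b^'a \<Rightarrow> real^'c^'a \<Rightarrow> real^('b + 'c)^'a" where
  "hcat A B = (\<chi> i j. case j of Inl k \<Rightarrow> A $ i $ k | Inr k \<Rightarrow> B $ i $ k)"

definition vcat :: "real^'c^'a \<Rightarrow> real^'c^'b \<Rightarrow> real^'c^('a + 'b)" where
  "vcat A B = (\<chi> i. case i of Inl k \<Rightarrow> A $ k | Inr k \<Rightarrow> B $ k)"

text \<open>The block matrix with first row \<open>A, B\<close> and second row \<open>B\<^sup>T, C\<close>.\<close>
definition sym_block :: "real^'a^'a \<Rightarrow> real^'b^'a \<Rightarrow> real^'b^'b \<Rightarrow> real^('a + 'b)^('a + 'b)" where
  "sym_block A B C = vcat (hcat A B) (hcat (transpose B) C)"

definition F_lam :: "real^'m^'m \<Rightarrow> real^1^'m \<Rightarrow> real^'m^1 \<Rightarrow> real \<Rightarrow> real^'m^'m" where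
  "F_lam F H K l = F + l *\<^sub>R (H ** K)"

definition lmi_matrix ::
  "real^'m^'m \<Rightarrow> real^1^'m \<Rightarrow> real^'m^1 \<Rightarrow> real^'m^'m \<Rightarrow> real \<Rightarrow> real \<Rightarrow> real \<Rightarrow> real
     \<Rightarrow> real^('m + 1 + 1 + 1)^('m + 1 + 1 + 1)" where
  "lmi_matrix F H K Q \<delta> \<xi> \<gamma> l =
     sym_block (Q ** transpose (F_lam F H K l) + F_lam F H K l ** Q)
       (hcat ((\<xi> - \<delta> * l) *\<^sub>R H + Q ** transpose K) (hcat H (l *\<^sub>R (Q ** transpose K))))
       (sym_block (mat (- 2 * \<delta>)) (hcat (mat 0) (mat (\<delta> * (1 - l))))
         (sym_block (mat (- \<gamma>)) (mat 1) (mat (- \<gamma>))))"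

end

theory Submission
  imports Defs
begin

text \<open>
Three ingredients combine, of which only the first is not linear algebra.

Every \<open>\<phi>\<close> in the class satisfies the sector condition \<open>\<phi> p \<bullet> (p - \<phi> p) \<ge> 0\<close>
(\<open>Phi_I_sector\<close>). The Jacobian condition says that \<open>2 J - I\<close> has operator norm at
most \<open>1\<close>, so \<open>\<psi> = 2 \<phi> - id\<close> is locally Lipschitz with a nonexpansive derivative almost
everywhere. Then \<open>\<psi>\<close> is nonexpansive, and \<open>norm (\<psi> p) \<le> norm p\<close> is the sector condition.
The difficulty is that a given segment may lie in the exceptional null set. Averaging
over a small ball of translates of the segment removes it: by dominated convergence the average
is differentiable along the segment, with derivative bounded by the almost-everywhere bound.

Each eigenvalue \<open>\<lambda>\<close> on the diagonal of \<open>\<Lambda>\<close> contributes one block \<open>\<eta>\<^sub>i\<close> of the state, and a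
dissipation inequality for that block comes from evaluating the quadratic form of the matrix
inequality at the vector \<open>(Q\<^sup>-\<^sup>1 \<eta>\<^sub>i, w\<^sub>i / \<delta>, b\<^sub>i, z\<^sub>i / \<gamma>)\<close> (\<open>lmi_mode_dissipation\<close>). The second
entry makes \<open>\<xi>\<close> appear as \<open>\<rho> = \<xi> / \<delta>\<close> and produces the multiplier term
\<open>(2 / \<delta>) x\<^sub>i w\<^sub>i\<close>; the last entry maximises over its slot and produces \<open>z\<^sub>i\<^sup>2 / \<gamma>\<close>. The matrix
inequality is affine in \<open>\<lambda>\<close>, so it passes from the two endpoints to every eigenvalue.

Finally the blocks are summed, with \<open>P = I \<otimes> Q\<^sup>-\<^sup>1\<close>. The multiplier terms are not sign definite
one by one, since \<open>\<phi>\<close> mixes the components, but they add up to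
\<open>(2 / \<delta>) (x \<bullet> w)\<close>, which is nonnegative by the sector condition. A compactness argument
(\<open>neg_def_coercive\<close>) supplies the uniform margin from which \<open>\<epsilon>\<close> is obtained.
\<close>

section \<open>Almost-everywhere derivative bounds for locally Lipschitz maps\<close>

lemma AE_lebesgue_translation:
  fixes a :: "'a::euclidean_space"
  assumes "AE u in lebesgue. P u"
  shows "AE v in lebesgue. P (v + a)"
proof -
  obtain N where N: "negligible N" "{u. \<not> P u} \<subseteq> N"
    using assms unfolding eventually_ae_filter_negligible by blast
  have "{v. \<not> P (v + a)} \<subseteq> (+) (- a) ` N"
  proof
    fix v assume "v \<in> {v. \<not> P (v + a)}"
    with N have "v + a \<in> N" by blast
    then have "- a + (v + a) \<in> (+) (- a) ` N" by blast
    then show "v \<in> (+) (- a) ` N" by simp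
  qed
  with N(1) show ?thesis
    unfolding eventually_ae_filter_negligible using negligible_translation by blast
qed

lemma locally_lipschitz_imp_lipschitz_on_compact:
  fixes f :: "'a::{metric_space, heine_borel} \<Rightarrow> 'b::metric_space"
  assumes "\<And>u. \<exists>r>0. \<exists>L. L-lipschitz_on (cball u r) f" and "compact S"
  obtains C where "C-lipschitz_on S f"
proof -
  \<comment> \<open>The time-dependent notion of local Lipschitz continuity is used with a single dummy time.\<close>
  have "local_lipschitz {0::real} S (\<lambda>_. f)"
  proof (rule local_lipschitzI)
    fix t :: real and x
    obtain r L where "r > 0" "L-lipschitz_on (cball x r) f"
      using assms(1) by blast
    then show "\<exists>u>0. \<exists>L. \<forall>t\<in>cball t u \<inter> {0}. L-lipschitz_on (cball x u \<inter> S) f"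
      by (meson inf_le1 lipschitz_on_subset)
  qed
  then obtain C where "\<forall>t\<in>{0::real}. C-lipschitz_on S f"
    using local_lipschitz_compact_implies_lipschitz[of "{0::real}" S "\<lambda>_. f"] assms(2)
    by auto
  then show thesis using that by blast
qed

lemma locally_lipschitz_imp_isCont:
  fixes h :: "'a::euclidean_space \<Rightarrow> 'b::metric_space"
  assumes "\<And>u. \<exists>r>0. \<exists>L. L-lipschitz_on (cball u r) h"
  shows "isCont h u"
proof -
  obtain r L where "r > 0" "L-lipschitz_on (cball u r) h" using assms by blast
  then show ?thesis
    using lipschitz_on_continuous_on continuous_on_interior[of "cball u r" h u] by fastforce
qed

lemma integrable_shift_on_cball:
  fixes h :: "'a::euclidean_space \<Rightarrow> real"
  assumes "\<And>u. isCont h u"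
  shows "integrable (lebesgue_on (cball x r)) (\<lambda>v. h (v + a))"
proof -
  interpret finite_measure "lebesgue_on (cball x r)"
    by (rule finite_measure_lebesgue_on) simp
  have cont: "continuous_on (cball x r) (\<lambda>v. h (v + a))"
    by (intro continuous_at_imp_continuous_on ballI
        isCont_o2[where g = h and f = "\<lambda>v. v + a"] assms continuous_intros)
  then have "bounded ((\<lambda>v. h (v + a)) ` cball x r)"
    by (intro compact_imp_bounded compact_continuous_image) auto
  then obtain b where "\<And>v. v \<in> cball x r \<Longrightarrow> norm (h (v + a)) \<le> b"
    unfolding bounded_iff by blast
  then show ?thesis
    by (intro integrable_const_bound[where B = b] AE_I2
        continuous_imp_measurable_on_sets_lebesgue cont) auto
qed

lemma has_derivative_directional_quotient:
  fixes h :: "'a::real_normed_vector \<Rightarrow> real"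
  assumes "(h has_derivative h') (at u)"
  shows "((\<lambda>t. (h (u + t *\<^sub>R e) - h u) / t) \<longlongrightarrow> h' e) (at 0)"
proof -
  have "((\<lambda>t. u + t *\<^sub>R e) has_derivative (\<lambda>t. t *\<^sub>R e)) (at 0)"
    by (auto intro!: derivative_eq_intros)
  moreover have "(h has_derivative h') (at (u + 0 *\<^sub>R e))" using assms by simp
  ultimately have "((\<lambda>t. h (u + t *\<^sub>R e)) has_derivative (\<lambda>t. h' (t *\<^sub>R e))) (at 0)"
    using has_derivative_compose by blast
  moreover have "h' (t *\<^sub>R e) = h' e * t" for t
    using linear_scale[OF has_derivative_linear[OF assms]] by (simp add: mult.commute)
  ultimately have "((\<lambda>t. h (u + t *\<^sub>R e)) has_field_derivative h' e) (at 0)"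
    by (simp add: has_field_derivative_def mult.commute[of _ "h' e"])
  then show ?thesis by (simp add: DERIV_def)
qed

text \<open>For each \<open>s\<close>, almost every \<open>v\<close> is such that \<open>h\<close> is differentiable at \<open>v + s e\<close>, because null sets
are translation invariant. The difference quotients in direction \<open>e\<close> are bounded by a Lipschitz
constant of \<open>h\<close> on a larger ball, so dominated convergence lets the derivative pass under the
integral.\<close>
lemma DERIV_integral_along_direction:
  fixes h :: "'a::euclidean_space \<Rightarrow> real" and x :: 'a and r :: real
  assumes loc: "\<And>u. \<exists>r>0. \<exists>L. L-lipschitz_on (cball u r) h"
    and ae: "AE u in lebesgue. \<exists>h'. (h has_derivative h') (at u) \<and> h' e \<le> B"
  defines "M \<equiv> lebesgue_on (cball x r)"
  shows "\<exists>D. DERIV (\<lambda>s. LINT v|M. h (v + s *\<^sub>R e)) s :> D \<and> D \<le> B * measure M (space M)"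
proof -
  have fin: "finite_measure M"
    unfolding M_def by (rule finite_measure_lebesgue_on) simp
  interpret finite_measure M by (fact fin)
  have space_M: "space M = cball x r" by (simp add: M_def)
  have int: "integrable M (\<lambda>v. h (v + a))" for a
    unfolding M_def by (intro integrable_shift_on_cball locally_lipschitz_imp_isCont[OF loc])
  note meas = borel_measurable_integrable[OF int]
  define q where "q t v = (h (v + s *\<^sub>R e + t *\<^sub>R e) - h (v + s *\<^sub>R e)) / t" for t v
  \<comment> \<open>The exceptional points force a measurable choice of the pointwise derivative: a limit along one
      fixed sequence is measurable, and it is the derivative wherever the latter exists.\<close>
  define D where "D v = lim (\<lambda>k. q (inverse (real (Suc k))) v)" for v
  have q_meas: "q t \<in> borel_measurable M" for t
    unfolding q_def add.assoc by (intro borel_measurable_divide borel_measurable_diff meas) auto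
  have D_meas: "D \<in> borel_measurable M"
    unfolding D_def by (intro borel_measurable_lim_metric q_meas)
  have q_lim: "AE v in M. ((\<lambda>t. q t v) \<longlongrightarrow> D v) (at 0) \<and> D v \<le> B"
  proof -
    have "AE v in lebesgue. \<exists>h'. (h has_derivative h') (at (v + s *\<^sub>R e)) \<and> h' e \<le> B"
      by (rule AE_lebesgue_translation[OF ae])
    then have "AE v in M. \<exists>h'. (h has_derivative h') (at (v + s *\<^sub>R e)) \<and> h' e \<le> B"
      unfolding M_def by (subst AE_restrict_space_iff) auto
    then show ?thesis
    proof (rule eventually_mono)
      fix v assume "\<exists>h'. (h has_derivative h') (at (v + s *\<^sub>R e)) \<and> h' e \<le> B"
      then obtain h' where h': "(h has_derivative h') (at (v + s *\<^sub>R e))" "h' e \<le> B" by blast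
      have lim: "((\<lambda>t. q t v) \<longlongrightarrow> h' e) (at 0)"
        unfolding q_def by (rule has_derivative_directional_quotient[OF h'(1)])
      have "filterlim (\<lambda>k. inverse (real (Suc k))) (at 0) sequentially"
        using LIMSEQ_inverse_real_of_nat by (auto simp: filterlim_at)
      then have "(\<lambda>k. q (inverse (real (Suc k))) v) \<longlonglongrightarrow> h' e"
        by (rule filterlim_compose[OF lim])
      then have "D v = h' e" unfolding D_def by (rule limI)
      then show "((\<lambda>t. q t v) \<longlongrightarrow> D v) (at 0) \<and> D v \<le> B" using lim h'(2) by simp
    qed
  qed
  obtain C where C: "C-lipschitz_on (cball x (r + (\<bar>s\<bar> + 1) * norm e)) h"
    using locally_lipschitz_imp_lipschitz_on_compact[OF loc compact_cball] .
  have q_bound: "norm (q t v) \<le> C * norm e" if t: "\<bar>t\<bar> < 1" "t \<noteq> 0" and v: "v \<in> cball x r" for t v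
  proof -
    have inside: "v + a *\<^sub>R e \<in> cball x (r + (\<bar>s\<bar> + 1) * norm e)" if "\<bar>a\<bar> \<le> \<bar>s\<bar> + 1" for a
    proof -
      have "norm ((v - x) + a *\<^sub>R e) \<le> norm (v - x) + \<bar>a\<bar> * norm e"
        using norm_triangle_ineq[of "v - x" "a *\<^sub>R e"] by simp
      also have "\<dots> \<le> r + (\<bar>s\<bar> + 1) * norm e"
        using v that by (intro add_mono mult_right_mono) (auto simp: dist_norm norm_minus_commute)
      finally show ?thesis by (simp add: dist_norm norm_minus_commute algebra_simps)
    qed
    have "norm (h (v + (s + t) *\<^sub>R e) - h (v + s *\<^sub>R e)) \<le>
        C * norm (v + (s + t) *\<^sub>R e - (v + s *\<^sub>R e))"
      using t by (intro lipschitz_on_normD[OF C] inside) auto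
    also have "v + (s + t) *\<^sub>R e - (v + s *\<^sub>R e) = t *\<^sub>R e" by (simp add: algebra_simps)
    finally have "\<bar>h (v + s *\<^sub>R e + t *\<^sub>R e) - h (v + s *\<^sub>R e)\<bar> \<le> C * norm e * \<bar>t\<bar>"
      by (simp add: algebra_simps)
    then show ?thesis using t by (simp add: q_def field_simps)
  qed
  have dom: "AE v in M. norm (q t v) \<le> C * norm e" if "\<bar>t\<bar> < 1" "t \<noteq> 0" for t
    using q_bound[OF that] by (intro AE_I2) (auto simp: space_M)
  have seq: "integrable M D \<and> (\<lambda>i. LINT v|M. q (T i) v) \<longlonglongrightarrow> (LINT v|M. D v)"
    if T: "\<And>i. T i \<in> ball 0 1 - {0}" "T \<longlonglongrightarrow> (0::real)" for T
  proof -
    have T': "\<bar>T i\<bar> < 1" "T i \<noteq> 0" for i using T(1)[of i] by auto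
    have "AE v in M. (\<lambda>i. q (T i) v) \<longlonglongrightarrow> D v"
    proof (rule eventually_mono[OF q_lim])
      fix v assume *: "((\<lambda>t. q t v) \<longlongrightarrow> D v) (at 0) \<and> D v \<le> B"
      have "filterlim T (at 0) sequentially" using T(2) T' by (auto simp: filterlim_at)
      then show "(\<lambda>i. q (T i) v) \<longlonglongrightarrow> D v" 
        by (rule filterlim_compose[OF conjunct1[OF *]])
    qed
    note dct = this dom[OF T'(1) T'(2)]
    have I: "integrable M (\<lambda>_. C * norm e)" by simp
    show ?thesis
      by (intro conjI integrable_dominated_convergence[OF D_meas q_meas I dct]
        integral_dominated_convergence[OF D_meas q_meas I dct])
  qed
  have D_int: "integrable M D"
  proof -
    \<comment> \<open>The double successor keeps every increment strictly below \<open>1\<close>, where the bound holds.\<close>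
    have "(\<lambda>i. inverse (real (Suc (Suc i)))) \<longlonglongrightarrow> 0"
      using LIMSEQ_inverse_real_of_nat by (rule LIMSEQ_Suc)
    moreover have "inverse (real (Suc (Suc i))) \<in> ball 0 1 - {0}" for i
      by (simp add: field_simps)
    ultimately show ?thesis
      using seq[of "\<lambda>i. inverse (real (Suc (Suc i)))"] by blast
  qed
  have "((\<lambda>t. LINT v|M. q t v) \<longlongrightarrow> (LINT v|M. D v)) (at 0 within ball 0 1)"
    unfolding tendsto_at_iff_sequentially comp_def
    by (intro allI impI conjunct2[OF seq]) auto
  then have "((\<lambda>t. LINT v|M. q t v) \<longlongrightarrow> (LINT v|M. D v)) (at 0)"
    by (simp add: at_within_open[of 0 "ball 0 1"])
  moreover have "(LINT v|M. q t v) =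
      ((LINT v|M. h (v + (s + t) *\<^sub>R e)) - (LINT v|M. h (v + s *\<^sub>R e))) / t" for t
    unfolding q_def add.assoc scaleR_left_distrib[symmetric]
    by (simp add: int Bochner_Integration.integral_diff)
  ultimately have "DERIV (\<lambda>s. LINT v|M. h (v + s *\<^sub>R e)) s :> (LINT v|M. D v)"
    by (simp add: DERIV_def)
  moreover have "(LINT v|M. D v) \<le> (LINT v|M. B)"
    by (rule integral_mono_AE[OF D_int]) (use q_lim in auto)
  ultimately show ?thesis by (auto simp: mult.commute)
qed

text \<open>The mean value theorem bounds the increment of \<open>h\<close> along \<open>e\<close>, averaged over the starting points in
a ball around \<open>x\<close>. As the ball shrinks, continuity turns the average into the increment at \<open>x\<close>.\<close>
lemma increment_le_of_AE_directional_derivative_le: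
  fixes h :: "'a::euclidean_space \<Rightarrow> real"
  assumes loc: "\<And>u. \<exists>r>0. \<exists>L. L-lipschitz_on (cball u r) h"
    and ae: "AE u in lebesgue. \<exists>h'. (h has_derivative h') (at u) \<and> h' e \<le> B"
  shows "h (x + e) - h x \<le> B"
proof (rule field_le_epsilon)
  fix \<epsilon> :: real assume "\<epsilon> > 0"
  note cont = locally_lipschitz_imp_isCont[OF loc]
  have "isCont (\<lambda>v. h (v + e) - h v) x"
    by (intro isCont_diff isCont_o2[where g = h and f = "\<lambda>v. v + e"] cont continuous_intros)
  then obtain d where "d > 0" and
    d: "\<And>v. dist v x < d \<Longrightarrow> dist (h (v + e) - h v) (h (x + e) - h x) < \<epsilon>"
    using \<open>\<epsilon> > 0\<close> unfolding continuous_at_eps_delta by blast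
  define r where "r = d / 2"
  have "r > 0" using \<open>d > 0\<close> by (simp add: r_def)
  define M where "M = lebesgue_on (cball x r)"
  interpret finite_measure M
    unfolding M_def by (rule finite_measure_lebesgue_on) simp
  have space_M: "space M = cball x r" by (simp add: M_def)
  have pos: "measure M (space M) > 0"
    using content_cball_pos[OF \<open>r > 0\<close>, of x]
    by (simp add: M_def measure_restrict_space)
  have shift: "integrable M (\<lambda>v. h (v + a))" for a
    unfolding M_def by (intro integrable_shift_on_cball cont)
  define \<Phi> where "\<Phi> s = (LINT v|M. h (v + s *\<^sub>R e))" for s
  have "\<forall>s. \<exists>D. DERIV \<Phi> s :> D \<and> D \<le> B * measure M (space M)"
    unfolding \<Phi>_def M_def using DERIV_integral_along_direction[OF loc ae] by blast
  then obtain D where D: "\<And>s. DERIV \<Phi> s :> D s" "\<And>s. D s \<le> B * measure M (space M)"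
    by metis
  obtain z where "\<Phi> 1 - \<Phi> 0 = (1 - 0) * D z"
    using MVT2[of 0 1 \<Phi> D] D(1) by auto
  then have "\<Phi> 1 - \<Phi> 0 \<le> B * measure M (space M)" using D(2) by simp
  moreover have "(LINT v|M. h (x + e) - h x - \<epsilon>) \<le> (LINT v|M. h (v + e) - h v)"
  proof (rule integral_mono)
    show "integrable M (\<lambda>v. h (v + e) - h v)" using shift[of e] shift[of 0] by simp
    fix v assume "v \<in> space M"
    then have "dist v x < d" using \<open>d > 0\<close> by (simp add: space_M r_def dist_commute)
    from d[OF this] show "h (x + e) - h x - \<epsilon> \<le> h (v + e) - h v" 
      unfolding dist_real_def by linarith
  qed simp
  moreover have "(LINT v|M. h (v + e) - h v) = \<Phi> 1 - \<Phi> 0"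
    using shift[of e] shift[of 0] by (simp add: \<Phi>_def)
  ultimately have "(h (x + e) - h x - \<epsilon>) * measure M (space M) \<le> B * measure M (space M)"
    by (simp add: mult.commute)
  with pos show "h (x + e) - h x \<le> B + \<epsilon>" by simp
qed

text \<open>The vector-valued case reduces to the real-valued one by projecting \<open>\<psi>\<close> onto the direction of its
own increment.\<close>
lemma nonexpansive_of_AE_derivative_nonexpansive:
  fixes \<psi> :: "'a::euclidean_space \<Rightarrow> 'b::real_inner"
  assumes loc: "\<And>u. \<exists>r>0. \<exists>L. L-lipschitz_on (cball u r) \<psi>"
    and ae: "AE u in lebesgue. \<exists>\<psi>'. (\<psi> has_derivative \<psi>') (at u) \<and> (\<forall>v. norm (\<psi>' v) \<le> norm v)"
  shows "norm (\<psi> y - \<psi> x) \<le> norm (y - x)"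
proof -
  define a where "a = \<psi> y - \<psi> x"
  have "a \<bullet> \<psi> (x + (y - x)) - a \<bullet> \<psi> x \<le> norm a * norm (y - x)"
  proof (rule increment_le_of_AE_directional_derivative_le)
    fix u
    obtain r L where r: "r > 0" "L-lipschitz_on (cball u r) \<psi>" using loc by blast
    have "(norm a * L)-lipschitz_on (cball u r) (\<lambda>u. a \<bullet> \<psi> u)"
    proof (rule lipschitz_onI)
      fix v w assume vw: "v \<in> cball u r" "w \<in> cball u r"
      have "\<bar>a \<bullet> (\<psi> v - \<psi> w)\<bar> \<le> norm a * norm (\<psi> v - \<psi> w)" by (rule Cauchy_Schwarz_ineq2)
      also have "\<dots> \<le> norm a * (L * norm (v - w))"
        by (intro mult_left_mono lipschitz_on_normD[OF r(2) vw]) simp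
      finally show "dist (a \<bullet> \<psi> v) (a \<bullet> \<psi> w) \<le> norm a * L * dist v w"
        by (simp add: dist_norm inner_diff_right algebra_simps)
    qed (use lipschitz_on_nonneg[OF r(2)] in simp)
    then show "\<exists>r>0. \<exists>L. L-lipschitz_on (cball u r) (\<lambda>u. a \<bullet> \<psi> u)" using r(1) by blast
  next
    show "AE u in lebesgue. \<exists>h'. ((\<lambda>u. a \<bullet> \<psi> u) has_derivative h') (at u) \<and>
        h' (y - x) \<le> norm a * norm (y - x)"
      using ae
    proof (rule eventually_mono)
      fix u assume "\<exists>\<psi>'. (\<psi> has_derivative \<psi>') (at u) \<and> (\<forall>v. norm (\<psi>' v) \<le> norm v)"
      then obtain \<psi>' where \<psi>': "(\<psi> has_derivative \<psi>') (at u)" "\<And>v. norm (\<psi>' v) \<le> norm v"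
        by blast
      have "((\<lambda>u. a \<bullet> \<psi> u) has_derivative (\<lambda>v. a \<bullet> \<psi>' v)) (at u)"
        using \<psi>'(1) by (auto intro!: derivative_eq_intros)
      moreover have "a \<bullet> \<psi>' (y - x) \<le> norm a * norm (y - x)"
        using norm_cauchy_schwarz[of a "\<psi>' (y - x)"] mult_left_mono[OF \<psi>'(2), of "norm a"]
        by (meson norm_ge_zero order_trans)
      ultimately show "\<exists>h'. ((\<lambda>u. a \<bullet> \<psi> u) has_derivative h') (at u) \<and>
          h' (y - x) \<le> norm a * norm (y - x)" by blast
    qed
  qed
  then have "norm a * norm a \<le> norm a * norm (y - x)"
    by (simp add: a_def inner_diff_right[symmetric] norm_eq_sqrt_inner flip: power2_eq_square)
  then show ?thesis unfolding a_def[symmetric] by (cases "a = 0") auto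
qed

section \<open>The sector condition\<close>

text \<open>The link between the sector condition and nonexpansiveness. It is used twice: for the Jacobian, and
for \<open>\<phi>\<close> itself.\<close>
lemma norm_reflection_le_iff:
  fixes v y :: "'a::real_inner"
  shows "norm (2 *\<^sub>R y - v) \<le> norm v \<longleftrightarrow> 0 \<le> y \<bullet> (v - y)"
  by (simp add: norm_le inner_simps inner_commute algebra_simps)

lemma inner_vector_matrix: "x \<bullet> (y v* M) = y \<bullet> (M *v x)" for M :: "real^'m^'n"
  by (simp add: inner_commute[of x] dot_lmul_matrix)

lemma nonsym_pos_semidef_sector:
  assumes "nonsym_pos_semidef (transpose J ** (mat 1 - J))"
  shows "0 \<le> (J *v v) \<bullet> (v - J *v v)"
proof -
  let ?M = "transpose J ** (mat 1 - J)"
  have "0 \<le> v \<bullet> ((?M + transpose ?M) *v v)"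
    using assms by (simp add: nonsym_pos_semidef_def pos_semidef_def)
  also have "\<dots> = 2 * (v \<bullet> (?M *v v))"
    by (simp add: matrix_vector_mult_add_rdistrib inner_add_right inner_vector_matrix)
  also have "v \<bullet> (?M *v v) = (J *v v) \<bullet> (v - J *v v)"
    by (simp add: inner_vector_matrix inner_commute matrix_vector_mult_diff_rdistrib
        flip: matrix_vector_mul_assoc)
  finally show ?thesis by simp
qed

lemma Phi_I_sector:
  fixes \<phi> :: "real^'n \<Rightarrow> real^'n"
  assumes "\<phi> \<in> Phi_I"
  shows "0 \<le> \<phi> p \<bullet> (p - \<phi> p)"
proof -
  have \<phi>0: "\<phi> 0 = 0"
    and loc: "\<And>u. \<exists>r>0. \<exists>L. L-lipschitz_on (cball u r) \<phi>"
    and ae: "AE u in lebesgue. \<phi> differentiable (at u) \<and>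
      nonsym_pos_semidef (transpose (jacobian \<phi> (at u)) ** (mat 1 - jacobian \<phi> (at u)))"
    using assms by (auto simp: Phi_I_def)
  define \<psi> where "\<psi> u = 2 *\<^sub>R \<phi> u - u" for u
  have "norm (\<psi> p - \<psi> 0) \<le> norm (p - 0)"
  proof (rule nonexpansive_of_AE_derivative_nonexpansive)
    fix u
    obtain r L where r: "r > 0" "L-lipschitz_on (cball u r) \<phi>" using loc by blast
    have "(\<bar>2\<bar> * L + 1)-lipschitz_on (cball u r) \<psi>"
      unfolding \<psi>_def by (intro lipschitz_intros r)
    with r(1) show "\<exists>r>0. \<exists>L. L-lipschitz_on (cball u r) \<psi>" by blast
  next
    show "AE u in lebesgue. \<exists>\<psi>'. (\<psi> has_derivative \<psi>') (at u) \<and> (\<forall>v. norm (\<psi>' v) \<le> norm v)"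
      using ae
    proof (rule eventually_mono)
      fix u
      let ?J = "jacobian \<phi> (at u)"
      assume *: "\<phi> differentiable (at u) \<and> nonsym_pos_semidef (transpose ?J ** (mat 1 - ?J))"
      have "(\<psi> has_derivative (\<lambda>v. 2 *\<^sub>R (?J *v v) - v)) (at u)"
        unfolding \<psi>_def using * by (auto intro!: derivative_eq_intros simp: jacobian_works)
      moreover have "norm (2 *\<^sub>R (?J *v v) - v) \<le> norm v" for v
        using nonsym_pos_semidef_sector * by (subst norm_reflection_le_iff) blast
      ultimately show "\<exists>\<psi>'. (\<psi> has_derivative \<psi>') (at u) \<and> (\<forall>v. norm (\<psi>' v) \<le> norm v)"
        by blast
    qed
  qed
  then show ?thesis by (simp add: \<psi>_def \<phi>0 norm_reflection_le_iff)
qed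

section \<open>Quadratic forms of block matrices\<close>

text \<open>The form attains a negative maximum on the compact unit sphere, and homogeneity carries the bound
to all vectors.\<close>
lemma neg_def_coercive:
  fixes M :: "real^'a^'a"
  assumes "neg_def M"
  obtains c where "c > 0" "\<And>v. v \<bullet> (M *v v) \<le> - c * (v \<bullet> v)"
proof -
  have "axis undefined 1 \<in> (sphere 0 1 :: (real^'a) set)" by simp
  then have "sphere 0 1 \<noteq> ({} :: (real^'a) set)" by blast
  moreover have "continuous_on (sphere 0 1) (\<lambda>v. v \<bullet> (M *v v))"
    by (intro continuous_intros linear_continuous_on) simp
  ultimately obtain w where w: "w \<in> sphere 0 1"
    "\<And>u. u \<in> sphere 0 1 \<Longrightarrow> u \<bullet> (M *v u) \<le> w \<bullet> (M *v w)"
    using continuous_attains_sup[of "sphere 0 1" "\<lambda>v. v \<bullet> (M *v v)"] by auto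
  define c where "c = - (w \<bullet> (M *v w))"
  have "c > 0" using w(1) assms unfolding c_def neg_def_def
    by (metis mem_sphere_0 neg_0_less_iff_less norm_zero zero_neq_one)
  moreover have "v \<bullet> (M *v v) \<le> - c * (v \<bullet> v)" for v
  proof (cases "v = 0")
    case False
    define u where "u = (1 / norm v) *\<^sub>R v"
    have v: "v = norm v *\<^sub>R u" using False by (simp add: u_def)
    have "u \<bullet> (M *v u) \<le> - c" using w(2)[of u] False by (simp add: c_def u_def)
    then have "(norm v)\<^sup>2 * (u \<bullet> (M *v u)) \<le> (norm v)\<^sup>2 * (- c)"
      by (rule mult_left_mono) simp
    moreover have "v \<bullet> (M *v v) = (norm v)\<^sup>2 * (u \<bullet> (M *v u))"
      by (subst (1 2) v) (simp add: matrix_vector_mult_scaleR power2_eq_square)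
    ultimately show ?thesis by (simp add: power2_norm_eq_inner mult.commute)
  qed simp
  ultimately show thesis using that by blast
qed

definition vjoin :: "real^'a \<Rightarrow> real^'b \<Rightarrow> real^('a + 'b)" where
  "vjoin x y = (\<chi> i. case i of Inl k \<Rightarrow> x $ k | Inr k \<Rightarrow> y $ k)"

lemma sum_UNIV_Plus:
  fixes f :: "'a::finite + 'b::finite \<Rightarrow> 'c::comm_monoid_add"
  shows "sum f UNIV = (\<Sum>i\<in>UNIV. f (Inl i)) + (\<Sum>j\<in>UNIV. f (Inr j))"
  by (simp add: sum.Plus flip: UNIV_Plus_UNIV)

lemma inner_vjoin [simp]: "vjoin x y \<bullet> vjoin x' y' = x \<bullet> x' + y \<bullet> y'"
  by (simp add: vjoin_def inner_vec_def sum_UNIV_Plus)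

lemma hcat_mult_vjoin [simp]: "hcat A B *v vjoin x y = A *v x + B *v y"
  by (simp add: vec_eq_iff hcat_def vjoin_def matrix_vector_mult_def sum_UNIV_Plus)

lemma vcat_mult: "vcat A B *v z = vjoin (A *v z) (B *v z)"
  by (auto simp: vec_eq_iff vcat_def vjoin_def matrix_vector_mult_def split: sum.split)

lemma sym_block_quadratic_form:
  "vjoin x y \<bullet> (sym_block A B C *v vjoin x y) =
    x \<bullet> (A *v x) + 2 * (x \<bullet> (B *v y)) + y \<bullet> (C *v y)"
  by (simp add: sym_block_def vcat_mult inner_add_right inner_vector_matrix)

lemma mat_mult_vec_one: "mat c *v (vec a :: real^1) = vec (c * a)"
  by (simp add: vec_eq_iff matrix_vector_mult_def mat_def)

lemma inner_vec_one [simp]: "(vec a :: real^1) \<bullet> vec b = a * b"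
  by (simp add: inner_vec_def)

lemma mult_vec_one: "H *v vec a = a *\<^sub>R (H *v (vec 1 :: real^1))" for H :: "real^1^'m"
  by (simp add: vec_eq_iff matrix_vector_mult_def)

lemma inner_vec_one': "(vec a :: real^1) \<bullet> v = a * v $ 1"
  by (simp add: inner_vec_def)

text \<open>The matrices \<open>H\<close> and \<open>K\<close> enter only through the two scalars \<open>p y\<close> and \<open>g y\<close>. With \<open>y = Q\<^sup>-\<^sup>1 \<eta>\<^sub>i\<close>, the first is the
controller output and the second the coefficient with which the controller input enters half of
the derivative of the Lyapunov function.\<close>
lemma lmi_quadratic_form:
  fixes F Q :: "real^'m^'m" and H :: "real^1^'m" and K :: "real^'m^1"
  assumes "transpose Q = Q"
  defines "v y a b c \<equiv> vjoin y (vjoin (vec a :: real^1) (vjoin (vec b :: real^1) (vec c :: real^1)))"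
  defines "p y \<equiv> (K *v (Q *v y)) $ 1" and "g y \<equiv> y \<bullet> (H *v vec 1)"
  shows "v y a b c \<bullet> (lmi_matrix F H K Q \<delta> \<xi> \<gamma> l *v v y a b c) =
    2 * (y \<bullet> (F *v (Q *v y))) + 2 * l * p y * g y
    + 2 * a * ((\<xi> - \<delta> * l) * g y + p y) + 2 * b * g y + 2 * l * c * p y
    - 2 * \<delta> * a\<^sup>2 + 2 * \<delta> * (1 - l) * a * c - \<gamma> * b\<^sup>2 + 2 * b * c - \<gamma> * c\<^sup>2"
proof -
  have QK: "y \<bullet> (Q ** transpose K *v vec a) = a * p y" for a
  proof -
    have "y \<bullet> (Q ** transpose K *v vec a) = y \<bullet> ((vec a v* K) v* Q)"
      by (metis assms(1) matrix_vector_mul_assoc transpose_matrix_vector)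
    also have "\<dots> = a * p y"
      by (simp add: inner_vector_matrix dot_lmul_matrix p_def inner_vec_one')
    finally show ?thesis .
  qed
  have FQ: "y \<bullet> (F_lam F H K l *v (Q *v y)) = y \<bullet> (F *v (Q *v y)) + l * p y * g y"
  proof -
    have "K *v (Q *v y) = vec (p y)" by (simp add: p_def vec_eq_iff)
    then have "(H ** K) *v (Q *v y) = p y *\<^sub>R (H *v vec 1)"
      by (metis matrix_vector_mul_assoc mult_vec_one)
    then show ?thesis
      by (simp add: F_lam_def matrix_vector_mult_add_rdistrib inner_add_right g_def
          flip: scaleR_matrix_vector_assoc)
  qed
  have QF: "y \<bullet> ((Q ** transpose (F_lam F H K l)) *v y) = y \<bullet> (F_lam F H K l *v (Q *v y))"
    using assms(1)
    by (metis dot_lmul_matrix inner_commute matrix_vector_mul_assoc transpose_matrix_vector)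
  have "y \<bullet> ((Q ** transpose (F_lam F H K l) + F_lam F H K l ** Q) *v y)
      = 2 * (y \<bullet> (F *v (Q *v y))) + 2 * l * p y * g y"
    by (simp only: matrix_vector_mult_add_rdistrib inner_add_right QF
        matrix_vector_mul_assoc[symmetric, of "F_lam F H K l"] FQ)
  moreover have "y \<bullet> (H *v vec t) = t * g y" for t
    by (subst mult_vec_one) (simp add: g_def)
  ultimately show ?thesis
    unfolding v_def lmi_matrix_def sym_block_quadratic_form
    by (simp add: mat_mult_vec_one inner_add_right matrix_vector_mult_add_rdistrib QK
        power2_eq_square algebra_simps flip: scaleR_matrix_vector_assoc)
qed

lemma affine_le_of_endpoints:
  fixes l :: real
  assumes "f + lmin * g \<le> k" "f + lmax * g \<le> k" "lmin \<le> l" "l \<le> lmax"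
  shows "f + l * g \<le> k"
proof (cases "g \<ge> 0")
  case True
  then have "l * g \<le> lmax * g" using assms(4) by (rule mult_right_mono[rotated])
  then show ?thesis using assms(2) by linarith
next
  case False
  then have "l * g \<le> lmin * g" using assms(3) by (intro mult_right_mono_neg) auto
  then show ?thesis using assms(1) by linarith
qed

section \<open>Block structure of the state\<close>

text \<open>The inverse is needed because the Lyapunov matrix is built from \<open>Q\<^sup>-\<^sup>1\<close>, whereas the matrix
inequality is stated in terms of \<open>Q\<close>.\<close>
lemma pos_def_inverse:
  assumes "pos_def Q"
  obtains R where "pos_def R" "Q ** R = mat 1"
proof -
  have sym: "transpose Q = Q" and pos: "\<And>x. x \<noteq> 0 \<Longrightarrow> 0 < x \<bullet> (Q *v x)"
    using assms by (auto simp: pos_def_def)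
  have "x = 0" if "Q *v x = 0" for x using pos[of x] that by force
  then obtain R where "R ** Q = mat 1" by (metis matrix_left_invertible_ker)
  then have QR: "Q ** R = mat 1" by (simp add: matrix_left_right_inverse)
  have "transpose R ** Q = mat 1"
    by (metis QR matrix_transpose_mul sym transpose_mat)
  then have "transpose R = R"
    by (metis QR matrix_mul_assoc matrix_mul_lid matrix_mul_rid)
  moreover have "0 < x \<bullet> (R *v x)" if "x \<noteq> 0" for x
  proof -
    have x: "Q *v (R *v x) = x" by (simp add: matrix_vector_mul_assoc QR)
    then have "R *v x \<noteq> 0" using that by force
    from pos[OF this] show ?thesis by (simp add: x inner_commute)
  qed
  ultimately show thesis using that QR by (auto simp: pos_def_def)
qed

definition block :: "real^('n::finite \<times> 'm::finite) \<Rightarrow> 'n \<Rightarrow> real^'m" where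
  "block \<eta> i = (\<chi> k. \<eta> $ (i, k))"

lemma sum_UNIV_Times:
  fixes f :: "'a::finite \<times> 'b::finite \<Rightarrow> 'c::comm_monoid_add"
  shows "sum f UNIV = (\<Sum>i\<in>UNIV. \<Sum>j\<in>UNIV. f (i, j))"
  by (simp add: sum.cartesian_product)

lemma inner_eq_sum_block: "\<eta> \<bullet> \<zeta> = (\<Sum>i\<in>UNIV. block \<eta> i \<bullet> block \<zeta> i)"
  by (simp add: inner_vec_def block_def sum_UNIV_Times)

lemma block_add: "block (\<eta> + \<zeta>) i = block \<eta> i + block \<zeta> i"
  by (simp add: block_def vec_eq_iff)

lemma block_kron: "block (kron (mat 1) M *v \<eta>) i = M *v block \<eta> i"
proof -
  have "(\<Sum>j\<in>UNIV. \<Sum>l\<in>UNIV. (if i = j then 1 else 0) * M $ k $ l * \<eta> $ (j, l)) =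
      (\<Sum>j\<in>UNIV. if i = j then \<Sum>l\<in>UNIV. M $ k $ l * \<eta> $ (j, l) else 0)" for k
    by (intro sum.cong) auto
  then show ?thesis
    by (simp add: vec_eq_iff block_def kron_def matrix_vector_mult_def mat_def sum_UNIV_Times)
qed

lemma block_H_ext: "block (H_ext H *v u) i = u $ i *\<^sub>R (H *v vec 1)"
proof -
  have "(\<Sum>j\<in>UNIV. (if i = j then 1 else 0) * H $ k $ 1 * u $ j) =
      (\<Sum>j\<in>UNIV. if i = j then u $ j * H $ k $ 1 else 0)" for k
    by (intro sum.cong) auto
  then show ?thesis
    by (simp add: vec_eq_iff block_def H_ext_def kron_def matrix_vector_mult_def mat_def)
qed

lemma K_ext_mult: "(K_ext K *v \<eta>) $ i = (K *v block \<eta> i) $ 1"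
proof -
  have "(\<Sum>j\<in>UNIV. \<Sum>l\<in>UNIV. (if i = j then 1 else 0) * K $ 1 $ l * \<eta> $ (j, l)) =
      (\<Sum>j\<in>UNIV. if i = j then \<Sum>l\<in>UNIV. K $ 1 $ l * \<eta> $ (j, l) else 0)"
    by (intro sum.cong) auto
  then show ?thesis
    by (simp add: block_def K_ext_def kron_def matrix_vector_mult_def mat_def sum_UNIV_Times)
qed

lemma pos_def_kron_mat_1:
  fixes R :: "real^'m^'m"
  assumes "pos_def R"
  shows "pos_def (kron (mat 1 :: real^'n^'n) R)"
proof -
  have R_sym: "transpose R = R" using assms by (simp add: pos_def_def)
  have "R $ j $ i = transpose R $ i $ j" for i j by (simp add: transpose_def)
  then have "R $ j $ i = R $ i $ j" for i j by (simp add: R_sym)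
  then have "transpose (kron (mat 1 :: real^'n^'n) R) = kron (mat 1) R"
    by (auto simp: vec_eq_iff transpose_def kron_def mat_def)
  moreover have "0 < \<eta> \<bullet> (kron (mat 1 :: real^'n^'n) R *v \<eta>)" if "\<eta> \<noteq> 0" for \<eta>
  proof -
    obtain i where "block \<eta> i \<noteq> 0"
      using \<open>\<eta> \<noteq> 0\<close> by (auto simp: vec_eq_iff block_def)
    moreover have "0 \<le> block \<eta> j \<bullet> (R *v block \<eta> j)" for j
      using assms by (cases "block \<eta> j = 0") (auto simp: pos_def_def intro: less_imp_le)
    ultimately show ?thesis
      using assms unfolding inner_eq_sum_block block_kron
      by (intro sum_pos2[where i = i]) (auto simp: pos_def_def)
  qed
  ultimately show ?thesis by (simp add: pos_def_def)
qed

lemma diag_matrix_mult: "(diag_matrix d *v x) $ i = d $ i * x $ i"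
proof -
  have "(\<Sum>j\<in>UNIV. (if i = j then d $ i else 0) * x $ j) =
      (\<Sum>j\<in>UNIV. if i = j then d $ i * x $ j else 0)"
    by (intro sum.cong) auto
  then show ?thesis by (simp add: diag_matrix_def matrix_vector_mult_def)
qed

text \<open>The diagonal entry is the value of the quadratic form of \<open>A\<close> at the unit vector \<open>V e\<^sub>i\<close>.\<close>
lemma eigendecomposition_entry_bounds:
  assumes "pos_semidef (A - lmin *\<^sub>R mat 1)" "pos_semidef (lmax *\<^sub>R mat 1 - A)"
    and "orthogonal_matrix V" "A = V ** diag_matrix d ** transpose V"
  shows "d $ i \<in> {lmin..lmax}"
proof -
  define v where "v = V *v axis i 1"
  have VV: "transpose V ** V = mat 1" using assms(3) by (simp add: orthogonal_matrix_def)
  have v: "v \<bullet> v = 1"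
  proof -
    have "v \<bullet> v = axis i 1 \<bullet> (transpose V *v (V *v axis i 1))"
      by (simp add: v_def inner_vector_matrix)
    also have "\<dots> = 1" by (simp only: matrix_vector_mul_assoc VV) simp
    finally show ?thesis .
  qed
  have "A *v v = (V ** diag_matrix d) *v ((transpose V ** V) *v axis i 1)"
    unfolding assms(4) v_def by (simp only: matrix_vector_mul_assoc matrix_mul_assoc)
  also have "\<dots> = V *v (diag_matrix d *v axis i 1)"
    by (simp add: VV matrix_vector_mul_assoc)
  also have "diag_matrix d *v axis i 1 = d $ i *\<^sub>R axis i 1"
    by (simp add: vec_eq_iff diag_matrix_mult axis_def)
  finally have Av: "v \<bullet> (A *v v) = d $ i"
    by (simp add: matrix_vector_mult_scaleR v flip: v_def)
  have "0 \<le> v \<bullet> ((A - lmin *\<^sub>R mat 1) *v v)" "0 \<le> v \<bullet> ((lmax *\<^sub>R mat 1 - A) *v v)"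
    using assms(1,2) by (auto simp: pos_semidef_def)
  then show ?thesis
    by (simp add: matrix_vector_mult_diff_rdistrib inner_diff_right Av v
        flip: scaleR_matrix_vector_assoc)
qed

text \<open>Evaluate the form with \<open>w / \<delta>\<close> in its second slot, and write \<open>\<lambda>\<close> for \<open>l\<close> and
\<open>\<rho>\<close> for \<open>\<xi> / \<delta>\<close>. The identity \<open>\<lambda> p + (\<rho> - \<lambda>) w = \<lambda> x + \<rho> w\<close> turns the
terms of the form that contain \<open>g\<close> into \<open>2 u g\<close>, and
\<open>\<lambda> p + (1 - \<lambda>) w + b = z\<close> turns those that contain the last slot \<open>e\<close> into
\<open>2 e z - \<gamma> e\<^sup>2\<close>, whose maximum \<open>z\<^sup>2 / \<gamma>\<close> is attained at \<open>e = z / \<gamma>\<close>.\<close>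
lemma lmi_mode_dissipation:
  fixes F Q :: "real^'m^'m" and H :: "real^1^'m" and K :: "real^'m^1" and y :: "real^'m"
    and c lmin lmax \<gamma> \<delta> \<xi> l x b :: real
  assumes "transpose Q = Q" and "\<gamma> > 0" "\<delta> > 0" "c \<ge> 0"
    and lmin: "\<And>v. v \<bullet> (lmi_matrix F H K Q \<delta> \<xi> \<gamma> lmin *v v) \<le> - c * (v \<bullet> v)"
    and lmax: "\<And>v. v \<bullet> (lmi_matrix F H K Q \<delta> \<xi> \<gamma> lmax *v v) \<le> - c * (v \<bullet> v)"
    and l: "l \<in> {lmin..lmax}"
  defines "p \<equiv> (K *v (Q *v y)) $ 1"
  defines "w \<equiv> p - x"
  defines "u \<equiv> l * x + b + \<xi> / \<delta> * w" and "z \<equiv> l * x + b + w"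
  shows "2 * (y \<bullet> (F *v (Q *v y) + u *\<^sub>R (H *v vec 1)))
    \<le> - c * (y \<bullet> y) - c * b\<^sup>2 - 1 / \<gamma> * z\<^sup>2 + \<gamma> * b\<^sup>2 - 2 / \<delta> * (x * w)"
proof -
  define g where "g = y \<bullet> (H *v vec 1)"
  define f where "f = y \<bullet> (F *v (Q *v y))"
  define a where "a = w / \<delta>"
  define e where "e = z / \<gamma>"
  \<comment> \<open>The form is split as \<open>q0 + l * q1\<close> to make its affine dependence on \<open>l\<close> explicit.\<close>
  define q0 where "q0 = 2 * f + 2 * a * (\<xi> * g + p) + 2 * b * g
    - 2 * \<delta> * a\<^sup>2 + 2 * \<delta> * a * e - \<gamma> * b\<^sup>2 + 2 * b * e - \<gamma> * e\<^sup>2"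
  define q1 where "q1 = 2 * p * g - 2 * \<delta> * a * g + 2 * e * p - 2 * \<delta> * a * e"
  define v where "v = vjoin y (vjoin (vec a :: real^1) (vjoin (vec b :: real^1) (vec e :: real^1)))"
  have form: "v \<bullet> (lmi_matrix F H K Q \<delta> \<xi> \<gamma> t *v v) = q0 + t * q1" for t
    unfolding v_def lmi_quadratic_form[OF assms(1)] q0_def q1_def
    by (fold p_def g_def f_def) (simp add: algebra_simps)
  have "q0 + l * q1 \<le> - c * (v \<bullet> v)"
    using lmin[of v] lmax[of v] l unfolding form
    by (intro affine_le_of_endpoints[of q0 lmin q1 _ lmax l]) auto
  also have "\<dots> \<le> - c * (y \<bullet> y) - c * b\<^sup>2"
  proof -
    have "c * (y \<bullet> y + b\<^sup>2) \<le> c * (v \<bullet> v)"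
      using \<open>c \<ge> 0\<close> by (intro mult_left_mono) (auto simp: v_def power2_eq_square)
    then show ?thesis by (simp add: algebra_simps)
  qed
  finally have bound: "q0 + l * q1 \<le> - c * (y \<bullet> y) - c * b\<^sup>2" .
  have "q0 + l * q1 = 2 * f + 2 * u * g + 2 / \<delta> * (x * w) - \<gamma> * b\<^sup>2 + 1 / \<gamma> * z\<^sup>2"
  proof -
    have w: "w = \<delta> * a" and z: "z = \<gamma> * e" and x: "x = p - \<delta> * a"
      using \<open>\<gamma> > 0\<close> \<open>\<delta> > 0\<close> by (simp_all add: a_def e_def w_def)
    have u: "u = l * (p - \<delta> * a) + b + \<xi> * a"
      using \<open>\<delta> > 0\<close> by (simp add: u_def w x)
    have z': "\<gamma> * e = l * (p - \<delta> * a) + b + \<delta> * a"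
      using z unfolding z_def by (simp add: w x)
    have "2 / \<delta> * (x * w) = 2 * (p - \<delta> * a) * a" "1 / \<gamma> * z\<^sup>2 = 2 * e * (\<gamma> * e) - \<gamma> * e\<^sup>2"
      using \<open>\<gamma> > 0\<close> \<open>\<delta> > 0\<close> by (simp_all add: w x z power2_eq_square)
    then show ?thesis
      unfolding u q0_def q1_def z' by (simp add: algebra_simps power2_eq_square)
  qed
  moreover have "y \<bullet> (F *v (Q *v y) + u *\<^sub>R (H *v vec 1)) = f + u * g"
    unfolding f_def g_def by (simp only: inner_add_right inner_scaleR_right)
  ultimately show ?thesis using bound by (simp add: algebra_simps)
qed

theorem proposition2:
  fixes lmin lmax :: real
    and A V :: "real^'n^'n" and d :: "real^'n"
    and F :: "real^'m^'m" and H :: "real^1^'m" and K :: "real^'m^1"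
    and Q :: "real^'m^'m" and \<gamma> \<delta> \<xi> :: real
  assumes "0 < lmin" and "lmin \<le> lmax"
    and "transpose A = A"
    and "pos_semidef (A - lmin *\<^sub>R mat 1)" and "pos_semidef (lmax *\<^sub>R mat 1 - A)"
    and "orthogonal_matrix V" and "A = V ** diag_matrix d ** transpose V"
    and "marginally_stable F"
    and "\<And>l. l \<in> {lmin..lmax} \<Longrightarrow> hurwitz (F + l *\<^sub>R (H ** K))"
    and "\<gamma> > 0"
    and "transpose Q = Q" and "pos_def Q"
    and "\<delta> > 0" and "\<xi> \<noteq> 0"
    and "neg_def (lmi_matrix F H K Q \<delta> \<xi> \<gamma> lmin)"
    and "neg_def (lmi_matrix F H K Q \<delta> \<xi> \<gamma> lmax)"
  shows "quadratic_performance F H K (diag_matrix d) (\<xi> / \<delta>) \<gamma>"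
proof -
  obtain R where R: "pos_def R" and QR: "Q ** R = mat 1"
    using pos_def_inverse[OF \<open>pos_def Q\<close>] .
  have R_sym: "v \<bullet> (R *v v') = (R *v v) \<bullet> v'" for v v'
    using R by (metis dot_lmul_matrix pos_def_def transpose_matrix_vector)
  obtain c1 c2 where "c1 > 0" "c2 > 0"
    and c1: "\<And>v. v \<bullet> (lmi_matrix F H K Q \<delta> \<xi> \<gamma> lmin *v v) \<le> - c1 * (v \<bullet> v)"
    and c2: "\<And>v. v \<bullet> (lmi_matrix F H K Q \<delta> \<xi> \<gamma> lmax *v v) \<le> - c2 * (v \<bullet> v)"
    using neg_def_coercive[OF assms(15)] neg_def_coercive[OF assms(16)] by metis
  define c where "c = min c1 c2"
  have "c > 0" using \<open>c1 > 0\<close> \<open>c2 > 0\<close> by (simp add: c_def)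
  have weaken: "- k * (v \<bullet> v) \<le> - c * (v \<bullet> v)" if "c \<le> k" for k and v :: "real^('m + 1 + 1 + 1)"
    using that by (simp add: mult_right_mono)
  have lmi: "v \<bullet> (lmi_matrix F H K Q \<delta> \<xi> \<gamma> lmin *v v) \<le> - c * (v \<bullet> v)"
    "v \<bullet> (lmi_matrix F H K Q \<delta> \<xi> \<gamma> lmax *v v) \<le> - c * (v \<bullet> v)" for v
    using order_trans[OF c1 weaken] order_trans[OF c2 weaken] by (auto simp: c_def)
  obtain B where "B > 0" and B: "\<And>y. norm (Q *v y) \<le> B * norm y"
    using linear_bounded_pos[OF matrix_vector_mul_linear[of Q]] by blast
  \<comment> \<open>The margin \<open>c\<close> is measured in \<open>Q\<^sup>-\<^sup>1 \<eta>\<close>, whence \<open>B\<^sup>2\<close>. Half of it is kept in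
      reserve to make the final inequality strict when \<open>\<eta> \<noteq> 0\<close>; when \<open>\<eta> = 0\<close>, the margin in \<open>b\<close> does.\<close>
  define \<epsilon> where "\<epsilon> = c / (2 * B\<^sup>2)"
  have "\<epsilon> > 0" using \<open>c > 0\<close> \<open>B > 0\<close> by (simp add: \<epsilon>_def)
  define P where "P = kron (mat 1 :: real^'n^'n) R"
  have "pos_def P" unfolding P_def by (rule pos_def_kron_mat_1[OF R])
  moreover have "2 * (\<eta> \<bullet> (P *v (F_ext F *v \<eta> + H_ext H *v u)))
      < - \<epsilon> * (\<eta> \<bullet> \<eta>) - 1 / \<gamma> * (z \<bullet> z) + \<gamma> * (b \<bullet> b)"
    if \<phi>: "\<phi> \<in> Phi_I" and nz: "(\<eta>, b) \<noteq> (0, 0)" and p: "p = K_ext K *v \<eta>" and x: "x = \<phi> p"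
      and w: "w = p - x" and u: "u = diag_matrix d *v x + b + (\<xi> / \<delta>) *\<^sub>R w"
      and z: "z = diag_matrix d *v x + b + w"
    for \<phi> :: "real^'n \<Rightarrow> real^'n" and \<eta> :: "real^('n \<times> 'm)" and b p x w u z
  proof -
    define y where "y i = R *v block \<eta> i" for i
    have Qy: "Q *v y i = block \<eta> i" for i by (simp add: y_def matrix_vector_mul_assoc QR)
    have "2 * (y i \<bullet> (F *v block \<eta> i + u $ i *\<^sub>R (H *v vec 1))) \<le>
        - (2 * \<epsilon>) * (block \<eta> i \<bullet> block \<eta> i) - c * (b $ i * b $ i) - 1 / \<gamma> * (z $ i * z $ i)
        + \<gamma> * (b $ i * b $ i) - 2 / \<delta> * (x $ i * w $ i)" (is "?V \<le> _") for i
    proof -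
      have "?V \<le> - c * (y i \<bullet> y i) - c * (b $ i)\<^sup>2 - 1 / \<gamma> * (z $ i)\<^sup>2
          + \<gamma> * (b $ i)\<^sup>2 - 2 / \<delta> * (x $ i * w $ i)"
        using lmi_mode_dissipation[OF \<open>transpose Q = Q\<close> \<open>\<gamma> > 0\<close> \<open>\<delta> > 0\<close> less_imp_le[OF \<open>c > 0\<close>]
            lmi eigendecomposition_entry_bounds[OF assms(4-7), of i],
            where y = "y i" and x = "x $ i" and b = "b $ i"]
        by (simp add: Qy u z w p diag_matrix_mult K_ext_mult)
      moreover have "2 * \<epsilon> * (block \<eta> i \<bullet> block \<eta> i) \<le> c * (y i \<bullet> y i)"
      proof -
        have "(norm (block \<eta> i))\<^sup>2 \<le> (B * norm (y i))\<^sup>2"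
          using B[of "y i"] by (intro power_mono) (auto simp: Qy)
        then have "2 * \<epsilon> * (norm (block \<eta> i))\<^sup>2 \<le> 2 * \<epsilon> * (B * norm (y i))\<^sup>2"
          using \<open>\<epsilon> > 0\<close> by (intro mult_left_mono) auto
        also have "\<dots> = c * (norm (y i))\<^sup>2"
          using \<open>B > 0\<close> by (simp add: \<epsilon>_def power_mult_distrib)
        finally show ?thesis by (simp add: power2_norm_eq_inner)
      qed
      ultimately show ?thesis by (simp add: power2_eq_square)
    qed
    then have "(\<Sum>i\<in>UNIV. 2 * (y i \<bullet> (F *v block \<eta> i + u $ i *\<^sub>R (H *v vec 1)))) \<le>
        (\<Sum>i\<in>UNIV. - (2 * \<epsilon>) * (block \<eta> i \<bullet> block \<eta> i) - c * (b $ i * b $ i)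
          - 1 / \<gamma> * (z $ i * z $ i) + \<gamma> * (b $ i * b $ i) - 2 / \<delta> * (x $ i * w $ i))"
      by (intro sum_mono)
    also have "\<dots> = - (2 * \<epsilon>) * (\<eta> \<bullet> \<eta>) - c * (b \<bullet> b) - 1 / \<gamma> * (z \<bullet> z)
        + \<gamma> * (b \<bullet> b) - 2 / \<delta> * (x \<bullet> w)"
      unfolding inner_eq_sum_block[of \<eta> \<eta>] unfolding inner_vec_def[of b] inner_vec_def[of z]
        inner_vec_def[of x] inner_real_def sum.distrib sum_subtractf sum_distrib_left ..
    finally have "2 * (\<eta> \<bullet> (P *v (F_ext F *v \<eta> + H_ext H *v u))) \<le>
        - (2 * \<epsilon>) * (\<eta> \<bullet> \<eta>) - c * (b \<bullet> b) - 1 / \<gamma> * (z \<bullet> z) + \<gamma> * (b \<bullet> b) - 2 / \<delta> * (x \<bullet> w)"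
      unfolding P_def F_ext_def inner_eq_sum_block[of \<eta> "kron _ _ *v _"] block_kron block_add
        block_H_ext y_def R_sym sum_distrib_left .
    moreover have "0 \<le> 2 / \<delta> * (x \<bullet> w)"
      using Phi_I_sector[OF \<phi>, of p] \<open>\<delta> > 0\<close> by (simp add: x w)
    moreover have "0 < \<epsilon> * (\<eta> \<bullet> \<eta>) + c * (b \<bullet> b)"
    proof (cases "\<eta> = 0")
      case True
      then show ?thesis using nz \<open>c > 0\<close> by simp
    next
      case False
      then show ?thesis using \<open>\<epsilon> > 0\<close> \<open>c > 0\<close> by (intro add_pos_nonneg) auto
    qed
    ultimately show ?thesis by simp
  qed
  ultimately show ?thesis
    unfolding quadratic_performance_def Let_def using \<open>\<epsilon> > 0\<close> by blast
qed

end
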